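(* Let $k\ge2$, $f\in P_k^n$ with $Ess(f)=\{x_1,\dots,x_n\}$, $n\ge1$. If $M\neq\emptyset$, $M\subset Ess(f)$ and $M\notin Sep(f)$, then there is an ordered decision diagram $D_f$ of $f$ with $Depth(D_f)<n+1$.
   Context: $Z_k=\{0,\dots,k-1\}$; $P_k^n$ is the set of functions $Z_k^n\to Z_k$ in variables $x_1,\dots,x_n$. $x_i$ is essential in $f$ if changing only the value of $x_i$ can change the value of $f$; $Ess(f)$ is the set of essential variables. For $x_i\in Ess(f)$, $c\in Z_k$, $f(x_i=c)$ is obtained by replacing $x_i$ by $c$, written $f(x_i=c)\prec f$; $\preceq$ is the reflexive–transitive closure of $\prec$. A non-empty $M\subseteq Ess(f)$ is separable in $f$ if $M=Ess(g)$ for some $g\preceq f$; $Sep(f)$ is the set of separable sets. Given a linear ordering of the variables, the ordered decomposition tree (ODT) of $f$ is the complete $k$-ary tree whose internal nodes at depth $d$ are labelled by the $d$-th variable, with outgoing edges labelled $0,\dots,k-1$ and leaves labelled by the value of $f$ at the assignment along the path; a function node sits above the root with one edge to it. The ordered decision diagram (ODD) is obtained from the ODT by repeatedly merging terminal nodes with equal labels and non-terminal nodes with equal labels and equal children, and removing non-terminal nodes all of whose children are identical, until neither rule applies. $Depth(D_f)$ is the number of edges in a longest path from the function node of $D_f$ to a leaf. *)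

theory Defs
  imports "HOL-Library.FuncSet" "HOL-Combinatorics.Multiset_Permutations"
begin

section \<open>Functions of k-valued logic\<close>

text \<open>The variable x_i is represented by its index i in {1..n}, an assignment by an extensional
  function on {1..n}.\<close>

definition Z :: "nat \<Rightarrow> nat set" where
  "Z k = {..<k}"

definition cube :: "nat \<Rightarrow> nat \<Rightarrow> (nat \<Rightarrow> nat) set" where
  "cube k n = {1..n} \<rightarrow>\<^sub>E Z k"

definition P :: "nat \<Rightarrow> nat \<Rightarrow> ((nat \<Rightarrow> nat) \<Rightarrow> nat) set" where
  "P k n = cube k n \<rightarrow>\<^sub>E Z k"

definition Ess :: "nat \<Rightarrow> nat \<Rightarrow> ((nat \<Rightarrow> nat) \<Rightarrow> nat) \<Rightarrow> nat set" where
  "Ess k n f = {i \<in> {1..n}. \<exists>a \<in> cube k n. \<exists>c \<in> Z k. f (a(i := c)) \<noteq> f a}"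

text \<open>The function f(x_i = c) is kept as a function of all n variables, in which x_i is
  no longer essential.\<close>

definition subst_var ::
  "nat \<Rightarrow> nat \<Rightarrow> ((nat \<Rightarrow> nat) \<Rightarrow> nat) \<Rightarrow> nat \<Rightarrow> nat \<Rightarrow> ((nat \<Rightarrow> nat) \<Rightarrow> nat)" where
  "subst_var k n f i c = (\<lambda>a \<in> cube k n. f (a(i := c)))"

definition immediate_subfunction ::
  "nat \<Rightarrow> nat \<Rightarrow> ((nat \<Rightarrow> nat) \<Rightarrow> nat) \<Rightarrow> ((nat \<Rightarrow> nat) \<Rightarrow> nat) \<Rightarrow> bool" where
  "immediate_subfunction k n g f \<longleftrightarrow> (\<exists>i \<in> Ess k n f. \<exists>c \<in> Z k. g = subst_var k n f i c)"

definition subfunction ::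
  "nat \<Rightarrow> nat \<Rightarrow> ((nat \<Rightarrow> nat) \<Rightarrow> nat) \<Rightarrow> ((nat \<Rightarrow> nat) \<Rightarrow> nat) \<Rightarrow> bool" where
  "subfunction k n = (immediate_subfunction k n)\<^sup>*\<^sup>*"

definition Sep :: "nat \<Rightarrow> nat \<Rightarrow> ((nat \<Rightarrow> nat) \<Rightarrow> nat) \<Rightarrow> nat set set" where
  "Sep k n f = {M. M \<noteq> {} \<and> M \<subseteq> Ess k n f \<and> (\<exists>g. subfunction k n g f \<and> M = Ess k n g)}"


section \<open>Decision diagrams\<close>

datatype node_label = Variable nat | Value nat

text \<open>The set \<open>nodes\<close> contains the terminal nodes (labelled by a \<open>Value\<close>) and the internal
  nodes (labelled by a \<open>Variable\<close>), but not the function node. The latter is never merged or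
  removed, so it is represented only by \<open>entry\<close>, the node its single outgoing edge leads to. The
  edge labelled c leaving an internal node v leads to \<open>child D v c\<close>; for terminal v, or for
  c outside \<open>Z k\<close>, that value has no meaning.\<close>

record 'v diagram =
  nodes :: "'v set"
  label :: "'v \<Rightarrow> node_label"
  child :: "'v \<Rightarrow> nat \<Rightarrow> 'v"
  entry :: 'v

definition terminal :: "'v diagram \<Rightarrow> 'v \<Rightarrow> bool" where
  "terminal D v \<longleftrightarrow> v \<in> nodes D \<and> (\<exists>c. label D v = Value c)"

definition internal :: "'v diagram \<Rightarrow> 'v \<Rightarrow> bool" where
  "internal D v \<longleftrightarrow> v \<in> nodes D \<and> (\<exists>i. label D v = Variable i)"

text \<open>The linear ordering of the variables is the list xs, an enumeration of {1..n}. The nodes of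
  the decomposition tree are the words over \<open>Z k\<close> of length at most n: the word w is the node
  reached from the root, which is the empty word, along the edges labelled by the letters of w.\<close>

definition path_assignment :: "nat \<Rightarrow> nat list \<Rightarrow> nat list \<Rightarrow> (nat \<Rightarrow> nat)" where
  "path_assignment n xs w = (\<lambda>i \<in> {1..n}. the (map_of (zip xs w) i))"

definition ODT ::
  "nat \<Rightarrow> nat \<Rightarrow> nat list \<Rightarrow> ((nat \<Rightarrow> nat) \<Rightarrow> nat) \<Rightarrow> nat list diagram" where
  "ODT k n xs f =
    \<lparr> nodes = {w. set w \<subseteq> Z k \<and> length w \<le> n},
      label = (\<lambda>w. if length w < n then Variable (xs ! length w)
                   else Value (f (path_assignment n xs w))),
      child = (\<lambda>w c. w @ [c]),
      entry = [] \<rparr>"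

text \<open>Delete the node u, all edges into u (including the one from the function node, if
  it leads to u) being redirected to v.\<close>

definition redirect :: "'v \<Rightarrow> 'v \<Rightarrow> 'v diagram \<Rightarrow> 'v diagram" where
  "redirect u v D =
    D\<lparr> nodes := nodes D - {u},
       child := (\<lambda>w c. if child D w c = u then v else child D w c),
       entry := (if entry D = u then v else entry D) \<rparr>"

inductive reduces :: "nat \<Rightarrow> 'v diagram \<Rightarrow> 'v diagram \<Rightarrow> bool" for k where
  merge_terminal:
    "terminal D u \<Longrightarrow> terminal D v \<Longrightarrow> u \<noteq> v \<Longrightarrow> label D u = label D v \<Longrightarrow>
     reduces k D (redirect u v D)"
| merge_internal:
    "internal D u \<Longrightarrow> internal D v \<Longrightarrow> u \<noteq> v \<Longrightarrow> label D u = label D v \<Longrightarrow>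
     (\<forall>c \<in> Z k. child D u c = child D v c) \<Longrightarrow>
     reduces k D (redirect u v D)"
| remove:
    "internal D u \<Longrightarrow> (\<forall>c \<in> Z k. child D u c = v) \<Longrightarrow>
     reduces k D (redirect u v D)"

definition is_ODD ::
  "nat \<Rightarrow> nat \<Rightarrow> ((nat \<Rightarrow> nat) \<Rightarrow> nat) \<Rightarrow> nat list diagram \<Rightarrow> bool" where
  "is_ODD k n f D \<longleftrightarrow>
    (\<exists>xs \<in> permutations_of_set {1..n}.
       (reduces k)\<^sup>*\<^sup>* (ODT k n xs f) D \<and> \<not> (\<exists>D'. reduces k D D'))"

text \<open>In the edge relation, \<open>None\<close> is the function node.\<close>

definition edges :: "nat \<Rightarrow> 'v diagram \<Rightarrow> ('v option \<times> 'v option) set" where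
  "edges k D =
    insert (None, Some (entry D)) {(Some v, Some (child D v c)) | v c. internal D v \<and> c \<in> Z k}"

definition Depth :: "nat \<Rightarrow> 'v diagram \<Rightarrow> nat" where
  "Depth k D = Max {m. \<exists>v. terminal D v \<and> (None, Some v) \<in> edges k D ^^ m}"

end

theory Submission
  imports Defs
begin

text \<open>
  Order the variables so that those outside M come first. In a reduced diagram distinct nodes
  compute distinct subfunctions of f. A path of length n + 1 tests every variable, so each variable
  it tests in M is essential in the subfunction g reached once all variables outside M are fixed.
  Hence M is the set of essential variables of g, that is, M is separable.
\<close>

section \<open>Essential variables under substitution\<close>

lemma fun_upd_in_cube: "a \<in> cube k n \<Longrightarrow> i \<in> {1..n} \<Longrightarrow> c \<in> Z k \<Longrightarrow> a(i := c) \<in> cube k n"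
  by (auto simp: cube_def PiE_iff extensional_def)

lemma Ess_subset: "Ess k n g \<subseteq> {1..n}"
  by (auto simp: Ess_def)

lemma upd_not_Ess:
  assumes "i \<notin> Ess k n g" "i \<in> {1..n}" "a \<in> cube k n" "c \<in> Z k"
  shows "g (a(i := c)) = g a"
  using assms by (auto simp: Ess_def)

text \<open>Extensionality turns agreement on \<open>cube k n\<close> into equality of
  functions.\<close>

lemma subst_var_not_Ess:
  assumes "g \<in> extensional (cube k n)" "i \<notin> Ess k n g" "i \<in> {1..n}" "c \<in> Z k"
  shows "subst_var k n g i c = g"
  using assms upd_not_Ess[of i k n g _ c]
  by (auto simp: subst_var_def fun_eq_iff extensional_def restrict_def)

lemma Ess_subst_var:
  assumes "i \<in> {1..n}" "c \<in> Z k"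
  shows "Ess k n (subst_var k n g i c) \<subseteq> Ess k n g - {i}"
proof
  fix j assume "j \<in> Ess k n (subst_var k n g i c)"
  then obtain a d where j: "j \<in> {1..n}" "a \<in> cube k n" "d \<in> Z k"
    and "subst_var k n g i c (a(j := d)) \<noteq> subst_var k n g i c a"
    by (auto simp: Ess_def)
  then have neq: "g (a(j := d, i := c)) \<noteq> g (a(i := c))"
    by (simp add: subst_var_def fun_upd_in_cube)
  \<comment> \<open>For j = i the update at i overwrites the one at j, and both sides
    coincide.\<close>
  then have "j \<noteq> i" by auto
  then have "g ((a(i := c))(j := d)) \<noteq> g (a(i := c))"
    using neq by (simp add: fun_upd_twist)
  moreover have "a(i := c) \<in> cube k n"
    using assms j by (simp add: fun_upd_in_cube)
  ultimately show "j \<in> Ess k n g - {i}"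
    using j \<open>j \<noteq> i\<close> unfolding Ess_def by blast
qed

text \<open>An essential variable gives one more step of \<open>immediate_subfunction\<close>; any
  other leaves g unchanged. Substitutions along a path thus need no case distinction.\<close>

lemma subfunction_subst_var:
  assumes "subfunction k n g f" "g \<in> extensional (cube k n)" "i \<in> {1..n}" "c \<in> Z k"
  shows "subfunction k n (subst_var k n g i c) f"
proof (cases "i \<in> Ess k n g")
  case True
  then have "immediate_subfunction k n (subst_var k n g i c) g"
    using assms(4) by (auto simp: immediate_subfunction_def)
  then show ?thesis
    using assms(1) unfolding subfunction_def by (rule converse_rtranclp_into_rtranclp)
next
  case False
  then show ?thesis using assms by (simp add: subst_var_not_Ess)
qed

text \<open>Every rule deletes one node; this is the measure that makes reduction terminate.\<close>

lemma card_nodes_reduces: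
  assumes "reduces k D D'" "finite (nodes D)"
  shows "card (nodes D') < card (nodes D)"
proof -
  have "\<exists>u \<in> nodes D. nodes D' = nodes D - {u}"
    using assms(1)
    by (induction rule: reduces.induct) (auto simp: redirect_def terminal_def internal_def)
  then show ?thesis using assms(2) by (metis card_Diff1_less)
qed

section \<open>Cofactors along a variable ordering\<close>

locale ordered_function =
  fixes k n :: nat and f :: "(nat \<Rightarrow> nat) \<Rightarrow> nat" and xs :: "nat list"
  assumes k_pos: "k > 0" and f_in_P: "f \<in> P k n"
    and set_xs: "set xs = {1..n}" and distinct_xs: "distinct xs"
begin

lemma length_xs: "length xs = n"
  using distinct_card[OF distinct_xs] set_xs by simp

lemma nth_xs: "j < n \<Longrightarrow> xs ! j \<in> {1..n}"
  using nth_mem[of j xs] length_xs set_xs by simp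

lemma zero_in_Z: "0 \<in> Z k"
  using k_pos by (simp add: Z_def)

lemma cube_nonempty: "\<exists>a. a \<in> cube k n"
proof
  show "(\<lambda>i \<in> {1..n}. 0) \<in> cube k n" using zero_in_Z by (auto simp: cube_def)
qed

definition plug :: "nat list \<Rightarrow> (nat \<Rightarrow> nat) \<Rightarrow> nat \<Rightarrow> nat" where
  "plug w a = (\<lambda>i. case map_of (zip xs w) i of None \<Rightarrow> a i | Some c \<Rightarrow> c)"

text \<open>The subfunction at the tree node w. It stays a function on the whole cube, so that
  cofactors of words of different lengths can be equal.\<close>

definition cofactor :: "nat list \<Rightarrow> (nat \<Rightarrow> nat) \<Rightarrow> nat" where
  "cofactor w = (\<lambda>a \<in> cube k n. f (plug w a))"

lemma cofactor_extensional: "cofactor w \<in> extensional (cube k n)"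
  by (simp add: cofactor_def)

lemma cofactor_Nil: "cofactor [] = f"
  using f_in_P by (auto simp: cofactor_def plug_def P_def PiE_iff extensional_def fun_eq_iff)

lemma plug_snoc:
  assumes "length w < n"
  shows "plug (w @ [c]) a = plug w (a(xs ! length w := c))"
proof -
  let ?x = "xs ! length w"
  have zip: "zip xs (w @ [c]) = zip xs w @ [(?x, c)]"
    using assms length_xs zip_append2[of xs w "[]"]
    by (simp add: zip_append2 Cons_nth_drop_Suc[symmetric])
  have "?x \<notin> set (take (length w) xs)"
    using assms distinct_xs length_xs
    by (auto simp: in_set_conv_nth nth_eq_iff_index_eq)
  \<comment> \<open>Earlier pairs take priority in \<open>map_of\<close>, so the appended pair takes
    effect only because its variable is new.\<close>
  then have "map_of (zip xs w) ?x = None"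
    by (force simp: map_of_eq_None_iff in_set_zip in_set_conv_nth)
  then show ?thesis
    by (auto simp: plug_def zip map_add_def fun_eq_iff split: option.splits)
qed

lemma cofactor_snoc:
  assumes "length w < n" "c \<in> Z k"
  shows "cofactor (w @ [c]) = subst_var k n (cofactor w) (xs ! length w) c"
  using assms nth_xs[of "length w"]
  by (auto simp: cofactor_def subst_var_def plug_snoc fun_upd_in_cube restrict_def fun_eq_iff)

lemma cofactor_snoc_apply:
  assumes "length w < n" "c \<in> Z k" "a \<in> cube k n"
  shows "cofactor (w @ [c]) a = cofactor w (a(xs ! length w := c))"
  using assms by (simp add: cofactor_snoc subst_var_def)

text \<open>Shannon expansion: at a point a, the child along the letter that a gives to the tested
  variable has the same value as the node, since that update leaves a unchanged.\<close>

lemma cofactor_eqI: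
  assumes "length u < n" "\<And>c. c \<in> Z k \<Longrightarrow> cofactor (u @ [c]) = subst_var k n g (xs ! length u) c"
    and "g \<in> extensional (cube k n)"
  shows "cofactor u = g"
proof (rule extensionalityI[OF cofactor_extensional assms(3)])
  fix a assume a: "a \<in> cube k n"
  let ?x = "xs ! length u"
  have c: "a ?x \<in> Z k"
    using a nth_xs[OF assms(1)] by (auto simp: cube_def)
  show "cofactor u a = g a"
    using cofactor_snoc_apply[OF assms(1) c a] assms(2)[OF c] a by (simp add: subst_var_def)
qed

lemma cofactor_full:
  assumes "length w = n" "a \<in> cube k n"
  shows "cofactor w a = f (path_assignment n xs w)"
proof -
  have "map_of (zip xs w) i \<noteq> None" if "i \<in> {1..n}" for i
    using that set_xs assms(1) length_xs map_fst_zip[of xs w]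
    by (simp add: map_of_eq_None_iff flip: set_map)
  \<comment> \<open>Outside {1..n} both assignments are \<open>undefined\<close>, as the equality
    below is one of functions on all naturals.\<close>
  moreover have "map_of (zip xs w) i = None \<and> a i = undefined" if "i \<notin> {1..n}" for i
    using that set_xs assms length_xs
    by (auto simp: map_of_eq_None_iff cube_def dest: set_zip_leftD)
  ultimately have "plug w a = path_assignment n xs w"
    by (fastforce simp: plug_def path_assignment_def fun_eq_iff split: option.splits)
  then show ?thesis using assms(2) by (simp add: cofactor_def)
qed

text \<open>Each letter removes the variable it fixes, and a substitution never creates an essential
  variable.\<close>

lemma Ess_cofactor:
  assumes "length w \<le> n" "set w \<subseteq> Z k"
  shows "Ess k n (cofactor w) \<subseteq> set (drop (length w) xs)"
  using assms
proof (induction w rule: rev_induct)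
  case Nil
  then show ?case using set_xs Ess_subset by simp
next
  case (snoc c w)
  have "Ess k n (cofactor (w @ [c])) \<subseteq> Ess k n (cofactor w) - {xs ! length w}"
    using snoc.prems nth_xs[of "length w"] by (simp add: cofactor_snoc Ess_subst_var)
  also have "\<dots> \<subseteq> set (drop (length w) xs) - {xs ! length w}"
    using snoc by auto
  also have "\<dots> \<subseteq> set (drop (Suc (length w)) xs)"
    using snoc.prems length_xs by (auto simp: Cons_nth_drop_Suc[symmetric])
  finally show ?case by simp
qed

lemma subfunction_cofactor:
  assumes "length w \<le> n" "set w \<subseteq> Z k"
  shows "subfunction k n (cofactor w) f"
  using assms
proof (induction w rule: rev_induct)
  case Nil
  then show ?case by (simp add: cofactor_Nil subfunction_def)
next
  case (snoc c w)
  then show ?case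
    using nth_xs[of "length w"]
    by (simp add: cofactor_snoc subfunction_subst_var cofactor_extensional)
qed

text \<open>Carries essentiality from a deeper cofactor back up to a shallower one.\<close>

lemma Ess_cofactor_append:
  assumes "length (w @ w') \<le> n" "set (w @ w') \<subseteq> Z k"
  shows "Ess k n (cofactor (w @ w')) \<subseteq> Ess k n (cofactor w)"
  using assms
proof (induction w' rule: rev_induct)
  case Nil
  then show ?case by simp
next
  case (snoc c w')
  have "cofactor (w @ w' @ [c])
      = subst_var k n (cofactor (w @ w')) (xs ! length (w @ w')) c"
    using cofactor_snoc[of "w @ w'" c] snoc.prems by simp
  moreover have "Ess k n (subst_var k n (cofactor (w @ w')) (xs ! length (w @ w')) c)
      \<subseteq> Ess k n (cofactor (w @ w')) - {xs ! length (w @ w')}"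
    using snoc.prems nth_xs[of "length (w @ w')"] by (intro Ess_subst_var) auto
  ultimately show ?case using snoc by auto
qed

section \<open>The invariant of reduction\<close>

text \<open>Redirecting never changes labels, so a node remains a word w over \<open>Z k\<close> with the label it
  has in the tree, and it keeps computing the cofactor of f at w.\<close>

definition computes :: "nat list diagram \<Rightarrow> bool" where
  "computes D \<longleftrightarrow>
     nodes D \<subseteq> nodes (ODT k n xs f) \<and> label D = label (ODT k n xs f) \<and>
     entry D \<in> nodes D \<and> cofactor (entry D) = f \<and>
     (\<forall>v \<in> nodes D. length v < n \<longrightarrow> (\<forall>c \<in> Z k.
        child D v c \<in> nodes D \<and> length v < length (child D v c) \<and>
        cofactor (child D v c) = cofactor (v @ [c])))"

lemma computes_ODT: "computes (ODT k n xs f)"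
  by (auto simp: computes_def ODT_def cofactor_Nil)

lemma computes_node: "computes D \<Longrightarrow> v \<in> nodes D \<Longrightarrow> set v \<subseteq> Z k \<and> length v \<le> n"
  by (auto simp: computes_def ODT_def)

lemma computes_label:
  "computes D \<Longrightarrow> label D w = (if length w < n then Variable (xs ! length w)
                                 else Value (f (path_assignment n xs w)))"
  by (simp add: computes_def ODT_def)

lemma computes_entry: "computes D \<Longrightarrow> entry D \<in> nodes D \<and> cofactor (entry D) = f"
  by (simp add: computes_def)

lemma computes_child:
  assumes "computes D" "v \<in> nodes D" "length v < n" "c \<in> Z k"
  shows "child D v c \<in> nodes D" "length v < length (child D v c)"
    "cofactor (child D v c) = cofactor (v @ [c])"
  using assms by (auto simp: computes_def)

lemma internal_iff: "computes D \<Longrightarrow> internal D v \<longleftrightarrow> v \<in> nodes D \<and> length v < n"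
  by (auto simp: internal_def computes_label)

lemma terminal_iff: "computes D \<Longrightarrow> terminal D v \<longleftrightarrow> v \<in> nodes D \<and> length v = n"
  using computes_node[of D v] by (auto simp: terminal_def computes_label)

lemma finite_nodes: "computes D \<Longrightarrow> finite (nodes D)"
  using finite_lists_length_le[of "Z k" n]
  by (auto simp: computes_def ODT_def Z_def intro: finite_subset)

text \<open>Both cofactors are constant on the nonempty cube, so they are determined by the leaf
  values, and conversely.\<close>

lemma cofactor_terminal:
  assumes "computes D" "terminal D u" "terminal D v"
  shows "cofactor u = cofactor v \<longleftrightarrow> label D u = label D v"
proof -
  have len: "length u = n" "length v = n"
    using assms by (auto simp: terminal_iff)
  obtain a where a: "a \<in> cube k n" using cube_nonempty by blast
  have "label D u = label D v \<longleftrightarrow> f (path_assignment n xs u) = f (path_assignment n xs v)"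
    using assms(1) len by (simp add: computes_label)
  also have "\<dots> \<longleftrightarrow> cofactor u = cofactor v"
    using cofactor_full[OF len(1)] cofactor_full[OF len(2)] a
    by (metis cofactor_extensional extensionalityI)
  finally show ?thesis by simp
qed

text \<open>Equal cofactors keep the computed functions; the length bound keeps every redirected
  edge leading to a strictly longer word, so the diagram stays acyclic.\<close>

lemma computes_redirect:
  assumes D: "computes D" and "v \<in> nodes D" "u \<noteq> v"
    and "cofactor u = cofactor v" "length u \<le> length v"
  shows "computes (redirect u v D)"
proof -
  have "\<And>w c. w \<in> nodes D \<Longrightarrow> length w < n \<Longrightarrow> c \<in> Z k \<Longrightarrow>
    child D w c = u \<Longrightarrow> length w < length v \<and> cofactor v = cofactor (w @ [c])"
    using computes_child[OF D] assms(4,5) by (metis order_less_le_trans)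
  then show ?thesis
    using assms by (auto simp: computes_def redirect_def)
qed

lemma reduces_computes:
  assumes "reduces k D D'" "computes D"
  shows "computes D'"
  using assms
proof (induction rule: reduces.induct)
  case (merge_terminal D u v)
  then show ?case
    using cofactor_terminal[of D u v] computes_redirect[of D v u] by (simp add: terminal_iff)
next
  case (merge_internal D u v)
  note D = \<open>computes D\<close>
  have u: "u \<in> nodes D" "length u < n" and v: "v \<in> nodes D" "length v < n"
    using merge_internal by (auto simp: internal_iff)
  \<comment> \<open>Equal labels name the same variable, and distinctness of \<open>xs\<close> makes
    its level unique.\<close>
  then have len: "length u = length v"
    using merge_internal distinct_xs length_xs
    by (auto simp: computes_label nth_eq_iff_index_eq)
  have "cofactor (u @ [c]) = subst_var k n (cofactor v) (xs ! length u) c" if "c \<in> Z k" for c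
    using computes_child(3)[OF D u that] computes_child(3)[OF D v that] cofactor_snoc[OF v(2) that]
      merge_internal that len by simp
  then have "cofactor u = cofactor v"
    using u(2) cofactor_extensional cofactor_eqI by blast
  then show ?case
    using computes_redirect[OF D v(1)] merge_internal(3) len by simp
next
  case (remove D u v)
  note D = \<open>computes D\<close>
  have u: "u \<in> nodes D" "length u < n"
    using remove by (auto simp: internal_iff)
  \<comment> \<open>The rule \<open>remove\<close> does not say that v is a node; it is one as the
    child of u along the edge 0.\<close>
  have v: "v \<in> nodes D" "length u < length v"
    using computes_child[OF D u zero_in_Z] remove zero_in_Z by auto
  have "cofactor (u @ [c]) = cofactor v" if "c \<in> Z k" for c
    using computes_child(3)[OF D u that] remove that by simp
  \<comment> \<open>v lies deeper than u, so its cofactor no longer depends on the variable tested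
    at u; this brings the children of u into the form needed by \<open>cofactor_eqI\<close>.\<close>
  moreover have "subst_var k n (cofactor v) (xs ! length u) c = cofactor v" if "c \<in> Z k" for c
  proof (rule subst_var_not_Ess)
    have "xs ! length u \<notin> set (drop (length v) xs)"
      using v(2) u(2) distinct_xs length_xs
      by (auto simp: in_set_conv_nth nth_eq_iff_index_eq)
    then show "xs ! length u \<notin> Ess k n (cofactor v)"
      using Ess_cofactor computes_node[OF D v(1)] by blast
  qed (use that u(2) nth_xs cofactor_extensional in auto)
  ultimately have "cofactor u = cofactor v"
    using u(2) cofactor_extensional cofactor_eqI by metis
  then show ?case
    using computes_redirect[OF D v(1)] v by force
qed

section \<open>Existence and canonicity of reduced diagrams\<close>

lemma reduced_exists:
  "computes D \<Longrightarrow> \<exists>D'. (reduces k)\<^sup>*\<^sup>* D D' \<and> computes D' \<and> \<not> (\<exists>E. reduces k D' E)"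
proof (induction "card (nodes D)" arbitrary: D rule: less_induct)
  case less
  show ?case
  proof (cases "\<exists>E. reduces k D E")
    case True
    then obtain E where E: "reduces k D E" by blast
    then show ?thesis
      using less reduces_computes[OF E] card_nodes_reduces[OF E] finite_nodes
      by (meson converse_rtranclp_into_rtranclp)
  next
    case False
    then show ?thesis using less.prems by blast
  qed
qed

text \<open>Induction from the leaves upwards; the measure drops when u or v is replaced by a child.
  Distinct nodes with equal cofactors would admit a rule: on the same level they are leaves with
  equal labels or have equal children by induction, so they merge; otherwise the shorter one does
  not depend on its own variable, all its children are the other node, and it can be
  removed.\<close>

lemma reduced_inj:
  assumes D: "computes D" and red: "\<not> (\<exists>E. reduces k D E)"
  shows "\<lbrakk>u \<in> nodes D; v \<in> nodes D; cofactor u = cofactor v\<rbrakk> \<Longrightarrow> u = v"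
proof (induction "2 * n - (length u + length v)" arbitrary: u v rule: less_induct)
  case less
  note node = computes_node[OF D]
  \<comment> \<open>The induction hypothesis is a premise here, so that the claim serves for both
    orders of the pair.\<close>
  have shorter: False if u: "u \<in> nodes D" and v: "v \<in> nodes D" and eq: "cofactor u = cofactor v"
    and lt: "length u < length v"
    and IH: "\<And>u' v'. 2 * n - (length u' + length v') < 2 * n - (length u + length v) \<Longrightarrow>
      u' \<in> nodes D \<Longrightarrow> v' \<in> nodes D \<Longrightarrow> cofactor u' = cofactor v' \<Longrightarrow> u' = v'" for u v
  proof -
    have un: "length u < n" using lt node[OF v] by simp
    have "child D u c = v" if c: "c \<in> Z k" for c
    proof (rule IH)
      show "2 * n - (length (child D u c) + length v) < 2 * n - (length u + length v)"
        using computes_child(2)[OF D u un c] un node[OF v] by linarith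
      have "xs ! length u \<notin> set (drop (length v) xs)"
        using lt un distinct_xs length_xs
        by (auto simp: in_set_conv_nth nth_eq_iff_index_eq)
      then have "xs ! length u \<notin> Ess k n (cofactor u)"
        using Ess_cofactor[of v] node[OF v] eq by auto
      then show "cofactor (child D u c) = cofactor v"
        using computes_child(3)[OF D u un c] cofactor_snoc[OF un c] eq nth_xs[OF un] c
        by (simp add: subst_var_not_Ess cofactor_extensional)
    qed (use computes_child(1)[OF D u un c] v in auto)
    then show False
      using red reduces.remove[of D u k v] un u D by (auto simp: internal_iff)
  qed
  consider "length u < length v" | "length v < length u" | "length u = length v" "length u < n"
    | "length u = n" "length v = n"
    using node[OF less.prems(1)] node[OF less.prems(2)] by linarith
  then show ?case
  proof cases
    case 1
    then show ?thesis using shorter[OF less.prems 1] less.hyps by blast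
  next
    case 2
    then show ?thesis
      using shorter[OF less.prems(2,1) less.prems(3)[symmetric] 2] less.hyps
      by (metis add.commute)
  next
    case 3
    have "child D u c = child D v c" if c: "c \<in> Z k" for c
    proof (rule less.hyps)
      note U = computes_child[OF D less.prems(1) 3(2) c]
      note V = computes_child[OF D less.prems(2) 3(2)[unfolded 3(1)] c]
      show "2 * n - (length (child D u c) + length (child D v c)) < 2 * n - (length u + length v)"
        using U(2) V(2) 3 by linarith
      show "child D u c \<in> nodes D" "child D v c \<in> nodes D" using U V by auto
      show "cofactor (child D u c) = cofactor (child D v c)"
        using U(3) V(3) 3 c less.prems(3) by (simp add: cofactor_snoc)
    qed
    then show ?thesis
      using red reduces.merge_internal[of D u v k] 3 less.prems D
      by (auto simp: internal_iff computes_label)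
  next
    case 4
    then show ?thesis
      using red reduces.merge_terminal[of D u v k] less.prems D cofactor_terminal[of D u v]
      by (auto simp: terminal_iff)
  qed
qed

section \<open>Paths in a reduced diagram\<close>

lemma edge_from_Some:
  assumes "computes D" "(Some v, y) \<in> edges k D"
  obtains c where "v \<in> nodes D" "length v < n" "c \<in> Z k" "y = Some (child D v c)"
  using assms by (auto simp: edges_def internal_iff)

text \<open>If m = length v, the path skips no level, and the word w consists of its edge labels.\<close>

lemma path_cofactors:
  assumes D: "computes D" and red: "\<not> (\<exists>E. reduces k D E)"
  shows "(None, y) \<in> edges k D ^^ Suc m \<Longrightarrow>
    \<exists>v. y = Some v \<and> v \<in> nodes D \<and> m \<le> length v \<and>
      (m = length v \<longrightarrow> (\<exists>w. set w \<subseteq> Z k \<and> length w = m \<and> cofactor w = cofactor v \<and>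
        (\<forall>e < m. cofactor (take e w) \<noteq> cofactor (take (Suc e) w))))"
proof (induction m arbitrary: y)
  case 0
  then have "y = Some (entry D)" by (auto simp: edges_def)
  then show ?case
    using computes_entry[OF D] by auto
next
  case (Suc m)
  then obtain z where z: "(None, z) \<in> edges k D ^^ Suc m" "(z, y) \<in> edges k D" by auto
  obtain v where v: "z = Some v" "v \<in> nodes D" "m \<le> length v"
    and path: "m = length v \<Longrightarrow> \<exists>w. set w \<subseteq> Z k \<and> length w = m \<and> cofactor w = cofactor v \<and>
        (\<forall>e < m. cofactor (take e w) \<noteq> cofactor (take (Suc e) w))"
    using Suc.IH[OF z(1)] by blast
  obtain c where c: "length v < n" "c \<in> Z k" "y = Some (child D v c)"
    using edge_from_Some[OF D] z(2) v(1) by metis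
  note C = computes_child[OF D v(2) c(1,2)]
  show ?case
  proof (rule exI[of _ "child D v c"], intro conjI impI)
    assume "Suc m = length (child D v c)"
    \<comment> \<open>From m \<le> \<open>length v\<close> < \<open>Suc m\<close>: the shorter path
      skipped no level either.\<close>
    then have m: "m = length v" using C(2) v(3) by linarith
    then obtain w where w: "set w \<subseteq> Z k" "length w = m" "cofactor w = cofactor v"
      "\<And>e. e < m \<Longrightarrow> cofactor (take e w) \<noteq> cofactor (take (Suc e) w)"
      using path by blast
    \<comment> \<open>v is the word that survived merging and may differ from w; both have length m,
      so the same variable is tested next.\<close>
    have eq: "cofactor (w @ [c]) = cofactor (child D v c)"
      using C(3) w m c by (simp add: cofactor_snoc)
    \<comment> \<open>The child is a longer word, hence a different node of a reduced
      diagram.\<close>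
    have "cofactor v \<noteq> cofactor (child D v c)"
      using reduced_inj[OF D red v(2) C(1)] C(2) by auto
    then have "cofactor (take e (w @ [c])) \<noteq> cofactor (take (Suc e) (w @ [c]))"
      if "e < Suc m" for e
      using that w eq by (cases "e = m") auto
    then show "\<exists>w. set w \<subseteq> Z k \<and> length w = Suc m \<and> cofactor w = cofactor (child D v c) \<and>
        (\<forall>e < Suc m. cofactor (take e w) \<noteq> cofactor (take (Suc e) w))"
      using w(1,2) c(2) eq by (intro exI[of _ "w @ [c]"]) auto
  qed (use c C v in auto)
qed

text \<open>Following edges labelled 0 lengthens the word until it reaches length n. This makes the
  set in \<open>Depth\<close> nonempty.\<close>

lemma terminal_reachable:
  assumes D: "computes D"
  shows "v \<in> nodes D \<Longrightarrow> (None, Some v) \<in> edges k D ^^ m \<Longrightarrow>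
    \<exists>m' v'. terminal D v' \<and> (None, Some v') \<in> edges k D ^^ m'"
proof (induction "n - length v" arbitrary: v m rule: less_induct)
  case less
  show ?case
  proof (cases "length v < n")
    case True
    note C = computes_child[OF D less.prems(1) True zero_in_Z]
    have "(Some v, Some (child D v 0)) \<in> edges k D"
      using less.prems True zero_in_Z D by (auto simp: edges_def internal_iff)
    then have "(None, Some (child D v 0)) \<in> edges k D ^^ Suc m"
      using less.prems(2) by auto
    moreover have "n - length (child D v 0) < n - length v"
      using C(2) True by linarith
    ultimately show ?thesis using less.hyps C(1) by blast
  next
    case False
    then show ?thesis
      using less.prems D computes_node[OF D less.prems(1)] by (auto simp: terminal_iff)
  qed
qed

section \<open>Long paths and separable sets\<close>

text \<open>If the variable at a level e \<ge> d were inessential in the cofactor at depth e, fixing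
  it would change nothing, against \<open>diff\<close>. Being essential there, it is essential
  already at depth d.\<close>

lemma Ess_cofactor_take:
  assumes w: "set w \<subseteq> Z k" "length w = n"
    and diff: "\<And>e. e < n \<Longrightarrow> cofactor (take e w) \<noteq> cofactor (take (Suc e) w)"
    and d: "d \<le> n"
  shows "Ess k n (cofactor (take d w)) = set (drop d xs)"
proof
  show "Ess k n (cofactor (take d w)) \<subseteq> set (drop d xs)"
    using Ess_cofactor[of "take d w"] w d by (auto dest: in_set_takeD)
  show "set (drop d xs) \<subseteq> Ess k n (cofactor (take d w))"
  proof
    fix x assume "x \<in> set (drop d xs)"
    then obtain e where e: "d \<le> e" "e < n" "x = xs ! e"
      using length_xs d by (auto simp: in_set_conv_nth) (metis add.commute le_add1 less_diff_conv)
    have c: "w ! e \<in> Z k" using w e by auto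
    have "cofactor (take (Suc e) w) = subst_var k n (cofactor (take e w)) x (w ! e)"
      using cofactor_snoc[of "take e w" "w ! e"] e c w by (simp add: take_Suc_conv_app_nth)
    then have "x \<in> Ess k n (cofactor (take e w))"
      using diff[OF e(2)] subst_var_not_Ess[OF cofactor_extensional] c e nth_xs by metis
    moreover have "take e w = take d w @ drop d (take e w)"
      using e(1) by (metis append_take_drop_id min.absorb1 take_take)
    ultimately show "x \<in> Ess k n (cofactor (take d w))"
      using Ess_cofactor_append[of "take d w" "drop d (take e w)"] w e
      by (auto dest: in_set_takeD)
  qed
qed

lemma Depth_reduced_less:
  assumes D: "computes D" and red: "\<not> (\<exists>E. reduces k D E)"
    and d: "d < n" and not_Sep: "set (drop d xs) \<notin> Sep k n f" and "Ess k n f = {1..n}"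
  shows "Depth k D < n + 1"
proof -
  let ?S = "{m. \<exists>v. terminal D v \<and> (None, Some v) \<in> edges k D ^^ m}"
  have bound: "m < n + 1" if m: "m \<in> ?S" for m
  proof (rule ccontr)
    assume "\<not> m < n + 1"
    \<comment> \<open>The first edge comes from the function node and tests no variable.\<close>
    then obtain m' where m': "m = Suc m'" "n \<le> m'" by (cases m) auto
    obtain v where v: "terminal D v" "(None, Some v) \<in> edges k D ^^ Suc m'"
      using m m' by blast
    \<comment> \<open>With m' \<le> \<open>length v\<close> from \<open>path_cofactors\<close> this
      gives m' = n, so the path skips no level and a word w is available.\<close>
    have "length v = n" using v D by (simp add: terminal_iff)
    then obtain w where w: "set w \<subseteq> Z k" "length w = n"
      and "\<forall>e < n. cofactor (take e w) \<noteq> cofactor (take (Suc e) w)"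
      using path_cofactors[OF D red v(2)] m'(2) by fastforce
    then have "Ess k n (cofactor (take d w)) = set (drop d xs)"
      using Ess_cofactor_take d by auto
    moreover have "subfunction k n (cofactor (take d w)) f"
      using w d by (intro subfunction_cofactor) (auto dest: in_set_takeD)
    moreover have "set (drop d xs) \<noteq> {}" "set (drop d xs) \<subseteq> Ess k n f"
      using d length_xs set_xs assms(5) by (auto dest: in_set_dropD)
    ultimately show False using not_Sep unfolding Sep_def by blast
  qed
  \<comment> \<open>\<open>Max\<close> obeys the bound only for a finite nonempty set.\<close>
  have "(None, Some (entry D)) \<in> edges k D ^^ 1" by (simp add: edges_def)
  then have "?S \<noteq> {}"
    using terminal_reachable[OF D] computes_entry[OF D] by blast
  moreover have "finite ?S"
    using bound by (intro finite_subset[of ?S "{..<n+1}"]) auto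
  ultimately show ?thesis
    using bound unfolding Depth_def by simp
qed

end

theorem theorem3p4:
  fixes k n :: nat and f :: "(nat \<Rightarrow> nat) \<Rightarrow> nat" and M :: "nat set"
  assumes "k \<ge> 2" and "n \<ge> 1"
    and "f \<in> P k n" and "Ess k n f = {1..n}"
    and "M \<noteq> {}" and "M \<subset> Ess k n f" and "M \<notin> Sep k n f"
  shows "\<exists>D. is_ODD k n f D \<and> Depth k D < n + 1"
proof -
  have M: "M \<subseteq> {1..n}" and fin: "finite M"
    using assms(4,6) by (auto intro: finite_subset)
  define ys where "ys = sorted_list_of_set ({1..n} - M)"
  define xs where "xs = ys @ sorted_list_of_set M"
  have xs: "set xs = {1..n}" "distinct xs"
    using M fin by (auto simp: xs_def ys_def)
  interpret ordered_function k n f xs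
    using assms xs by unfold_locales auto
  \<comment> \<open>At depth \<open>length ys\<close> exactly the variables of M are left to
    test.\<close>
  have drop: "set (drop (length ys) xs) = M"
    using fin by (simp add: xs_def)
  have "length ys < n"
    using drop assms(5) length_xs by (metis drop_all empty_set not_le)
  obtain D where D: "(reduces k)\<^sup>*\<^sup>* (ODT k n xs f) D" "computes D" "\<not> (\<exists>E. reduces k D E)"
    using reduced_exists[OF computes_ODT] by blast
  have "xs \<in> permutations_of_set {1..n}"
    using xs by (simp add: permutations_of_set_def)
  then have "is_ODD k n f D"
    using D unfolding is_ODD_def by blast
  moreover have "Depth k D < n + 1"
    using Depth_reduced_less[OF D(2,3) \<open>length ys < n\<close>] drop assms(4,7) by simp
  ultimately show ?thesis by blast
qed

end
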